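(* Let $A,R,X$ be pairwise disjoint finite sets of propositional variables and let $f$ be a formula in $(A\uplus R,X)$-layered smooth decision-DNNF, with bounds $U(f)$ and $L(f)$ computed by the algorithm Relax. If $R=\varnothing$, then $U(f)=L(f)=\mathrm{emajsat}_A(f)$.
   Context: Decision-DNNF. A formula in decision-DNNF is a DAG built from the following nodes ($V(f)$ denotes the set of variables of $f$): (i) $\top$ and $\bot$, with $V(\top)=V(\bot)=\varnothing$; (ii) decomposable And nodes $\bigwedge_{i=1}^n f_i$ where the $f_i$ are in decision-DNNF and $V(f_i)\cap V(f_j)=\varnothing$ for $i\ne j$; (iii) decision nodes $\mathrm{ite}(v,g,h)$ ("if $v$ then $g$ else $h$") where $v$ is a variable, $g,h$ are in decision-DNNF, $v\notin V(g)$ and $v\notin V(h)$; $V(\mathrm{ite}(v,g,h))=\{v\}\cup V(g)\cup V(h)$. The formula is smooth if $V(g)=V(h)$ for every decision node $\mathrm{ite}(v,g,h)$. For disjoint sets $Y,Z$ of variables, it is $(Y,Z)$-layered if $V(f)\subseteq Y\uplus Z$ and, for every decision node $\mathrm{ite}(v,g,h)$, $v\in Z$ implies $V(g)\subseteq Z$ (for smooth formulas, hence also $V(h)\subseteq Z$). E-MAJSAT. With $\mathbb B=\{\top,\bot\}$ and $a\in\mathbb B^A$, $f|_a$ is $f$ with each variable $v\in A$ replaced by $a(v)$; $\sharp(f|_a)$ is its number of models, counted as valuations of $V(f)\setminus A$. Then $\mathrm{emajsat}_A(f)=\max_{a\in\mathbb B^A}\sharp(f|_a)$. Upper bound $U$: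 $U(\top)=1$, $U(\bot)=0$; $U(\mathrm{ite}(v,g,h))=U(g)+U(h)$ if $v\in X$ or $v\in R$; $U(\mathrm{ite}(v,g,h))=\max(U(g),U(h))$ if $v\in A$; $U(\bigwedge_{i=1}^n g_i)=\prod_{i=1}^n U(g_i)$. Witness. For a set $B$ of variables and $f$ in $(B,X)$-layered smooth decision-DNNF, define $C(f)\in\mathbb N$ and $w_B(f)\in\mathbb B^B$ inductively, where $a_\bot\in\mathbb B^B$ maps every variable to $\bot$ and $a[v:=b]$ is $a$ modified to map $v$ to $b$: $C(\top)=1$, $C(\bot)=0$, $w_B(\top)=w_B(\bot)=a_\bot$; for $v\notin B$, $C(\mathrm{ite}(v,g,h))=C(g)+C(h)$ and $w_B(\mathrm{ite}(v,g,h))=a_\bot$; for $v\in B$, if $C(g)<C(h)$ then $C(\mathrm{ite}(v,g,h))=C(h)$ and $w_B(\mathrm{ite}(v,g,h))=w_B(h)[v:=\bot]$, otherwise $C(\mathrm{ite}(v,g,h))=C(g)$ and $w_B(\mathrm{ite}(v,g,h))=w_B(g)[v:=\top]$; $C(\bigwedge_i g_i)=\prod_i C(g_i)$ and $w_B(\bigwedge_i g_i)$ is the combination of the $w_B(g_i)$: it agrees with $w_B(g_i)$ on $B\cap V(g_i)$ for each $i$ and maps all other variables of $B$ to $\bot$. Lower bound $L$: let $w\in\mathbb B^A$ be the restriction of $w_{A\cup R}(f)$ to $A$; then $L(f)=\sharp(f|_w)$ (models counted over $V(f)\setminus A$). *)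

theory Defs
  imports Main "HOL-Library.FuncSet"
begin

text \<open>A DAG is represented by its tree unfolding. All notions below are defined by recursion on the
  nodes, so the sharing of subgraphs does not affect their values.\<close>

datatype 'v formula =
    Top
  | Bot
  | And "'v formula list"
  | Ite 'v "'v formula" "'v formula"

fun vars :: "'v formula \<Rightarrow> 'v set" where
  "vars Top = {}"
| "vars Bot = {}"
| "vars (And fs) = (\<Union>f\<in>set fs. vars f)"
| "vars (Ite v g h) = {v} \<union> vars g \<union> vars h"

fun eval :: "('v \<Rightarrow> bool) \<Rightarrow> 'v formula \<Rightarrow> bool" where
  "eval m Top = True"
| "eval m Bot = False"
| "eval m (And fs) = (\<forall>f\<in>set fs. eval m f)"
| "eval m (Ite v g h) = (if m v then eval m g else eval m h)"

fun nodes :: "'v formula \<Rightarrow> 'v formula set" where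
  "nodes Top = {Top}"
| "nodes Bot = {Bot}"
| "nodes (And fs) = {And fs} \<union> (\<Union>f\<in>set fs. nodes f)"
| "nodes (Ite v g h) = {Ite v g h} \<union> nodes g \<union> nodes h"

inductive decision_dnnf :: "'v formula \<Rightarrow> bool" where
  "decision_dnnf Top"
| "decision_dnnf Bot"
| "\<lbrakk>\<And>f. f \<in> set fs \<Longrightarrow> decision_dnnf f;
    \<And>i j. \<lbrakk>i < length fs; j < length fs; i \<noteq> j\<rbrakk> \<Longrightarrow> vars (fs ! i) \<inter> vars (fs ! j) = {}\<rbrakk>
   \<Longrightarrow> decision_dnnf (And fs)"
| "\<lbrakk>decision_dnnf g; decision_dnnf h; v \<notin> vars g; v \<notin> vars h\<rbrakk>
   \<Longrightarrow> decision_dnnf (Ite v g h)"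

definition smooth :: "'v formula \<Rightarrow> bool" where
  "smooth f \<longleftrightarrow> (\<forall>v g h. Ite v g h \<in> nodes f \<longrightarrow> vars g = vars h)"

definition layered :: "'v set \<Rightarrow> 'v set \<Rightarrow> 'v formula \<Rightarrow> bool" where
  "layered Y Z f \<longleftrightarrow> vars f \<subseteq> Y \<union> Z \<and>
     (\<forall>v g h. Ite v g h \<in> nodes f \<longrightarrow> v \<in> Z \<longrightarrow> vars g \<subseteq> Z)"

text \<open>Valuations of a set \<open>S\<close> of variables are the elements of \<open>S \<rightarrow>\<^sub>E UNIV\<close>.
  Replacing each variable \<open>v \<in> A\<close> of \<open>f\<close> by the constant \<open>a v\<close> amounts to evaluating \<open>f\<close> under
  valuations overridden by \<open>a\<close> on \<open>A\<close>. The models are counted over \<open>vars f - A\<close>, even if some of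
  these variables become irrelevant after the replacement.\<close>

definition model_count :: "'v set \<Rightarrow> ('v \<Rightarrow> bool) \<Rightarrow> 'v formula \<Rightarrow> nat" where
  "model_count A a f =
     card {m \<in> (vars f - A) \<rightarrow>\<^sub>E (UNIV :: bool set). eval (override_on m a A) f}"

definition emajsat :: "'v set \<Rightarrow> 'v formula \<Rightarrow> nat" where
  "emajsat A f = Max ((\<lambda>a. model_count A a f) ` (A \<rightarrow>\<^sub>E (UNIV :: bool set)))"

text \<open>For an \<open>(A \<union> R, X)\<close>-layered formula, the decision variables outside \<open>A\<close> are those
  in \<open>X\<close> or \<open>R\<close>.\<close>

fun upper_bound :: "'v set \<Rightarrow> 'v formula \<Rightarrow> nat" where
  "upper_bound A Top = 1"
| "upper_bound A Bot = 0"
| "upper_bound A (And fs) = (\<Prod>f\<leftarrow>fs. upper_bound A f)"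
| "upper_bound A (Ite v g h) =
     (if v \<in> A then max (upper_bound A g) (upper_bound A h)
      else upper_bound A g + upper_bound A h)"

fun witness_count :: "'v set \<Rightarrow> 'v formula \<Rightarrow> nat" where
  "witness_count B Top = 1"
| "witness_count B Bot = 0"
| "witness_count B (And fs) = (\<Prod>f\<leftarrow>fs. witness_count B f)"
| "witness_count B (Ite v g h) =
     (if v \<notin> B then witness_count B g + witness_count B h
      else if witness_count B g < witness_count B h then witness_count B h
      else witness_count B g)"

text \<open>In the case of a decomposable And node, each variable occurs in at most one child, so that
  the existential quantifier below selects the value given by the witness of that child, and
  yields \<open>False\<close> if there is no such child.\<close>

fun witness :: "'v set \<Rightarrow> 'v formula \<Rightarrow> 'v \<Rightarrow> bool" where
  "witness B Top = (\<lambda>u\<in>B. False)"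
| "witness B Bot = (\<lambda>u\<in>B. False)"
| "witness B (And fs) = (\<lambda>u\<in>B. \<exists>f\<in>set fs. u \<in> vars f \<and> witness B f u)"
| "witness B (Ite v g h) =
     (if v \<notin> B then (\<lambda>u\<in>B. False)
      else if witness_count B g < witness_count B h then (witness B h)(v := False)
      else (witness B g)(v := True))"

definition lower_bound :: "'v set \<Rightarrow> 'v set \<Rightarrow> 'v formula \<Rightarrow> nat" where
  "lower_bound A R f = model_count A (restrict (witness (A \<union> R) f) A) f"

end

theory Submission imports Defs begin

text \<open>Fixing an assignment \<open>a\<close> of \<open>A\<close>, the model count satisfies the recursion defining the upper bound
  (thanks to decomposability and smoothness), except that a decision on \<open>v \<in> A\<close> selects the child
  given by \<open>a v\<close> instead of the maximum. Hence every count is below the upper bound. The witness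
  selects the maximal child at each decision on \<open>A\<close>, and below a decision outside \<open>A\<close> layering leaves
  no variable of \<open>A\<close>, so that its count attains the upper bound.\<close>

lemma finite_vars [simp]: "finite (vars f)"
  by (induction f) auto

lemma eval_cong: "(\<And>v. v \<in> vars f \<Longrightarrow> m v = m' v) \<Longrightarrow> eval m f = eval m' f"
  by (induction f) auto

lemma smooth_And: "smooth (And fs) \<Longrightarrow> f \<in> set fs \<Longrightarrow> smooth f"
  unfolding smooth_def by auto

lemma smooth_Ite: "smooth (Ite v g h) \<Longrightarrow> smooth g \<and> smooth h \<and> vars g = vars h"
  unfolding smooth_def by auto

lemma layered_And: "layered Y Z (And fs) \<Longrightarrow> f \<in> set fs \<Longrightarrow> layered Y Z f"
  unfolding layered_def by (auto; blast)

lemma layered_Ite: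
  "layered Y Z (Ite v g h) \<Longrightarrow>
    layered Y Z g \<and> layered Y Z h \<and> v \<in> Y \<union> Z \<and> (v \<in> Z \<longrightarrow> vars g \<subseteq> Z)"
  unfolding layered_def by auto

text \<open>Values of the assignment outside \<open>vars f\<close> never reach an evaluation of
  \<open>f\<close>. This allows passing between the witness of a node and that of a child, whatever
  the default values are.\<close>

lemma model_count_cong:
  assumes "\<And>v. v \<in> vars f \<inter> A \<Longrightarrow> a v = b v"
  shows "model_count A a f = model_count A b f"
proof -
  have "eval (override_on m a A) f = eval (override_on m b A) f" for m
    using assms by (intro eval_cong) (auto simp: override_on_def)
  then show ?thesis
    by (simp add: model_count_def)
qed

lemma model_count_Top [simp]: "model_count A a Top = 1"
  by (simp add: model_count_def)

lemma model_count_Bot [simp]: "model_count A a Bot = 0"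
  by (simp add: model_count_def)

lemma model_count_And_Nil: "model_count A a (And []) = 1"
  by (simp add: model_count_def)

text \<open>Decomposability: a model of the conjunction is a pair of independent models of its two
  parts, obtained by restriction and glued back by overriding.\<close>

lemma model_count_And_Cons:
  assumes "vars f \<inter> vars (And fs) = {}"
  shows "model_count A a (And (f # fs)) = model_count A a f * model_count A a (And fs)"
proof -
  let ?models = "\<lambda>f. {m \<in> (vars f - A) \<rightarrow>\<^sub>E (UNIV :: bool set). eval (override_on m a A) f}"
  let ?split = "\<lambda>m. (restrict m (vars f - A), restrict m (vars (And fs) - A))"
  let ?merge = "\<lambda>(m, n). override_on n m (vars f - A)"
  have eval_left: "eval (override_on m a A) f = eval (override_on n a A) f"
    if "\<And>v. v \<in> vars f - A \<Longrightarrow> m v = n v" for m n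
    using that by (intro eval_cong) (auto simp: override_on_def)
  have eval_right: "eval (override_on m a A) (And fs) = eval (override_on n a A) (And fs)"
    if "\<And>v. v \<in> vars (And fs) - A \<Longrightarrow> m v = n v" for m n
    using that by (intro eval_cong) (auto simp: override_on_def)
  have "bij_betw ?split (?models (And (f # fs))) (?models f \<times> ?models (And fs))"
  proof (rule bij_betw_byWitness[where f' = ?merge])
    show "\<forall>m\<in>?models (And (f # fs)). ?merge (?split m) = m"
      by (auto simp: override_on_def fun_eq_iff PiE_def extensional_def)
    \<comment> \<open>By disjointness, overriding on \<open>vars f - A\<close> touches no variable
      of \<open>And fs\<close>, so the second component is recovered.\<close>
    show "\<forall>p\<in>?models f \<times> ?models (And fs). ?split (?merge p) = p"
      using assms by (auto simp: override_on_def fun_eq_iff PiE_def extensional_def)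
    show "?split ` ?models (And (f # fs)) \<subseteq> ?models f \<times> ?models (And fs)"
    proof (rule image_subsetI)
      fix m assume "m \<in> ?models (And (f # fs))"
      then have "eval (override_on m a A) f" "eval (override_on m a A) (And fs)"
        by auto
      then have "eval (override_on (restrict m (vars f - A)) a A) f"
          "eval (override_on (restrict m (vars (And fs) - A)) a A) (And fs)"
        using eval_left[of m "restrict m (vars f - A)"]
          eval_right[of m "restrict m (vars (And fs) - A)"] by auto
      then show "?split m \<in> ?models f \<times> ?models (And fs)"
        by auto
    qed
    show "?merge ` (?models f \<times> ?models (And fs)) \<subseteq> ?models (And (f # fs))"
    proof (rule image_subsetI, clarify)
      fix m n assume m: "m \<in> vars f - A \<rightarrow>\<^sub>E (UNIV :: bool set)"
        and n: "n \<in> vars (And fs) - A \<rightarrow>\<^sub>E (UNIV :: bool set)"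
        and evals: "eval (override_on m a A) f" "eval (override_on n a A) (And fs)"
      let ?o = "override_on n m (vars f - A)"
      have "eval (override_on ?o a A) f"
        using evals(1) eval_left[of m ?o] by simp
      moreover have "eval (override_on ?o a A) (And fs)"
        using assms evals(2) by (subst eval_right[of _ n]) (auto simp: override_on_def simp del: eval.simps)
      moreover have "?o \<in> vars (And (f # fs)) - A \<rightarrow>\<^sub>E UNIV"
        using m n by (auto simp: override_on_def PiE_def extensional_def)
      ultimately show "?o \<in> vars (And (f # fs)) - A \<rightarrow>\<^sub>E UNIV \<and>
          eval (override_on ?o a A) (And (f # fs))"
        by simp
    qed
  qed
  then show ?thesis
    by (simp only: model_count_def bij_betw_same_card card_cartesian_product)
qed

lemma model_count_And:
  assumes "\<And>i j. \<lbrakk>i < length fs; j < length fs; i \<noteq> j\<rbrakk> \<Longrightarrow> vars (fs ! i) \<inter> vars (fs ! j) = {}"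
  shows "model_count A a (And fs) = (\<Prod>f\<leftarrow>fs. model_count A a f)"
  using assms
proof (induction fs)
  case Nil
  show ?case
    by (simp add: model_count_And_Nil)
next
  case (Cons f fs)
  have "vars f \<inter> vars (fs ! j) = {}" if "j < length fs" for j
    using Cons.prems[of 0 "Suc j"] that by simp
  then have "vars f \<inter> vars g = {}" if "g \<in> set fs" for g
    using that by (metis in_set_conv_nth)
  then have "vars f \<inter> vars (And fs) = {}"
    by auto
  moreover have "vars (fs ! i) \<inter> vars (fs ! j) = {}"
    if "i < length fs" "j < length fs" "i \<noteq> j" for i j
    using Cons.prems[of "Suc i" "Suc j"] that by simp
  ultimately show ?case
    by (simp add: model_count_And_Cons Cons.IH)
qed

text \<open>The variable \<open>v\<close> is fixed by \<open>a\<close>, and smoothness makes both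
  branches count over the same variables, so the selected branch needs no correction factor.\<close>

lemma model_count_Ite_mem:
  assumes "v \<in> A" "vars g = vars h" "v \<notin> vars g"
  shows "model_count A a (Ite v g h) = model_count A a (if a v then g else h)"
proof -
  have "vars (Ite v g h) - A = vars g - A"
    using assms by auto
  then show ?thesis
    using assms by (simp add: model_count_def)
qed

text \<open>The models split by their value at \<open>v\<close>; by smoothness, each half is a copy
  of the models of one branch, extended at \<open>v\<close>.\<close>

lemma model_count_Ite_not_mem:
  assumes "v \<notin> A" "vars g = vars h" "v \<notin> vars g"
  shows "model_count A a (Ite v g h) = model_count A a g + model_count A a h"
proof -
  let ?S = "vars g - A"
  let ?models = "\<lambda>f. {m \<in> ?S \<rightarrow>\<^sub>E (UNIV :: bool set). eval (override_on m a A) f}"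
  let ?extend = "\<lambda>b m. m(v := b)"
  have dom: "vars (Ite v g h) - A = insert v ?S"
    using assms by auto
  have upd: "eval (override_on (m(v := b)) a A) f = eval (override_on m a A) f"
    if "f = g \<or> f = h" for m b f
    using assms that by (intro eval_cong) (auto simp: override_on_def)
  have "{m \<in> insert v ?S \<rightarrow>\<^sub>E (UNIV :: bool set). eval (override_on m a A) (Ite v g h)}
      = ?extend True ` ?models g \<union> ?extend False ` ?models h" (is "?lhs = ?rhs")
  proof
    show "?lhs \<subseteq> ?rhs"
    proof
      fix m assume "m \<in> ?lhs"
      then obtain b n where m: "m = n(v := b)" and n: "n \<in> ?S \<rightarrow>\<^sub>E (UNIV :: bool set)"
        and ev: "eval (override_on m a A) (Ite v g h)"
        by (auto simp: PiE_insert_eq)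
      show "m \<in> ?rhs"
        using m n ev assms(1) upd by (cases b) auto
    qed
    show "?rhs \<subseteq> ?lhs"
      using assms(1) upd by (auto simp: PiE_insert_eq)
  qed
  \<comment> \<open>Extending at \<open>v\<close> is injective: valuations of \<open>?S\<close> all
    have the same \<open>undefined\<close> value at \<open>v\<close>, so nothing is lost by
    overwriting it.\<close>
  moreover have "card (?extend b ` ?models f) = card (?models f)" for b f
    using assms(3) by (intro card_image inj_on_subset[OF inj_onI[of "?S \<rightarrow>\<^sub>E (UNIV :: bool set)"]])
      (auto simp: fun_eq_iff PiE_def extensional_def, metis+)
  moreover have "?extend True ` ?models g \<inter> ?extend False ` ?models h = {}"
    by (auto dest: fun_cong[of _ _ v])
  moreover have "finite (?models f)" for f
    by (rule finite_subset[of _ "?S \<rightarrow>\<^sub>E UNIV"]) (auto intro: finite_PiE)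
  ultimately show ?thesis
    unfolding model_count_def dom using assms(2) by (simp add: card_Un_disjoint)
qed

text \<open>With the same set of maximised variables the comparison of counts is just
  \<open>max\<close>. This is where empty \<open>R\<close> matters: in general the witness maximises
  over \<open>A \<union> R\<close>, the upper bound over \<open>A\<close> only.\<close>

lemma witness_count_eq_upper_bound: "witness_count A f = upper_bound A f"
  by (induction f) (auto simp: max_def cong: map_cong)

lemma prod_list_map_mono:
  fixes p q :: "'a \<Rightarrow> nat"
  shows "(\<And>x. x \<in> set xs \<Longrightarrow> p x \<le> q x) \<Longrightarrow> (\<Prod>x\<leftarrow>xs. p x) \<le> (\<Prod>x\<leftarrow>xs. q x)"
  by (induction xs) (auto intro: mult_le_mono)

text \<open>Sums, products and maxima of naturals are monotone, so replacing the child selected by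
  \<open>a\<close> with the larger one can only increase the count.\<close>

lemma model_count_le_upper_bound:
  assumes "decision_dnnf f" "smooth f"
  shows "model_count A a f \<le> upper_bound A f"
  using assms
proof (induction rule: decision_dnnf.induct)
  case (3 fs)
  then show ?case
    by (auto simp: model_count_And intro!: prod_list_map_mono dest: smooth_And)
next
  case (4 g h v)
  then have "smooth g" "smooth h" "vars g = vars h"
    by (auto dest: smooth_Ite)
  with 4 show ?case
    by (cases "v \<in> A") (auto simp: model_count_Ite_mem model_count_Ite_not_mem le_max_iff_disj add_mono)
qed auto

text \<open>A shared variable forces equal positions, hence equal members. Thus the existential
  quantifier in \<open>witness\<close> at an And node refers to a single child.\<close>

lemma nth_unique_of_disjoint:
  assumes "\<And>i j. \<lbrakk>i < length fs; j < length fs; i \<noteq> j\<rbrakk> \<Longrightarrow> vars (fs ! i) \<inter> vars (fs ! j) = {}"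
    and "f \<in> set fs" "f' \<in> set fs" "u \<in> vars f" "u \<in> vars f'"
  shows "f' = f"
  using assms by (metis IntI empty_iff in_set_conv_nth)

lemma model_count_witness:
  assumes "decision_dnnf f" "smooth f" "layered A X f" "A \<inter> X = {}"
  shows "model_count A (witness A f) f = upper_bound A f"
  using assms(1-3)
proof (induction rule: decision_dnnf.induct)
  case (3 fs)
  have "model_count A (witness A (And fs)) f = upper_bound A f" if f: "f \<in> set fs" for f
  proof -
    have "witness A (And fs) u = witness A f u" if "u \<in> vars f \<inter> A" for u
      using that f nth_unique_of_disjoint[OF "3.hyps"(2)] by auto
    then have "model_count A (witness A (And fs)) f = model_count A (witness A f) f"
      by (rule model_count_cong)
    also have "\<dots> = upper_bound A f"
      using 3 f by (blast intro: smooth_And layered_And)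
    finally show ?thesis .
  qed
  then show ?case
    using "3.hyps"(2) by (simp add: model_count_And del: witness.simps cong: map_cong)
next
  case (4 g h v)
  then have sm: "vars g = vars h" and v: "v \<in> A \<union> X" "v \<in> X \<Longrightarrow> vars g \<subseteq> X"
    and g: "model_count A (witness A g) g = upper_bound A g"
    and h: "model_count A (witness A h) h = upper_bound A h"
    by (auto dest: smooth_Ite layered_Ite)
  show ?case
  proof (cases "v \<in> A")
    case True
    \<comment> \<open>As \<open>v\<close> occurs in neither branch, recording the decision on
      \<open>v\<close> does not change the count of the branch.\<close>
    have "model_count A ((witness A g)(v := True)) g = upper_bound A g"
      using 4 g by (subst model_count_cong[of _ _ _ "witness A g"]) auto
    moreover have "model_count A ((witness A h)(v := False)) h = upper_bound A h"
      using 4 h by (subst model_count_cong[of _ _ _ "witness A h"]) auto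
    ultimately show ?thesis
      using True sm 4 by (simp add: model_count_Ite_mem witness_count_eq_upper_bound)
  next
    case False
    \<comment> \<open>Here \<open>v\<close> lies in \<open>X\<close>, so layering puts
      \<open>vars g\<close> inside \<open>X\<close>, and smoothness carries this over to
      \<open>h\<close>. The counts of both branches are then independent of the assignment, and the
      all-\<open>False\<close> witness is as good as any.\<close>
    then have "vars g \<inter> A = {}" "vars h \<inter> A = {}"
      using v sm assms(4) by auto
    then have "model_count A (witness A (Ite v g h)) g = upper_bound A g"
      "model_count A (witness A (Ite v g h)) h = upper_bound A h"
      using g h model_count_cong[of g A] model_count_cong[of h A] by (metis empty_iff)+
    then show ?thesis
      using False sm 4 by (simp add: model_count_Ite_not_mem del: witness.simps)
  qed
qed auto

theorem proposition7p11:
  fixes A R X :: "'v set" and f :: "'v formula"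
  assumes "finite A" and "finite R" and "finite X"
    and "A \<inter> R = {}" and "A \<inter> X = {}" and "R \<inter> X = {}"
    and "decision_dnnf f" and "smooth f" and "layered (A \<union> R) X f"
    and "R = {}"
  shows "upper_bound A f = lower_bound A R f \<and> lower_bound A R f = emajsat A f"
proof -
  \<comment> \<open>For empty \<open>R\<close> this is the assignment whose models
    \<open>lower_bound\<close> counts.\<close>
  let ?w = "restrict (witness A f) A"
  have "model_count A ?w f = model_count A (witness A f) f"
    by (rule model_count_cong) simp
  also have "\<dots> = upper_bound A f"
    using assms by (intro model_count_witness) auto
  finally have w: "model_count A ?w f = upper_bound A f" .
  have "emajsat A f = upper_bound A f"
    unfolding emajsat_def
  proof (rule Max_eqI)
    show "finite ((\<lambda>a. model_count A a f) ` (A \<rightarrow>\<^sub>E (UNIV :: bool set)))"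
      using assms(1) by (intro finite_imageI finite_PiE) auto
    show "n \<le> upper_bound A f"
      if "n \<in> (\<lambda>a. model_count A a f) ` (A \<rightarrow>\<^sub>E (UNIV :: bool set))" for n
      using that model_count_le_upper_bound[OF assms(7,8)] by auto
    \<comment> \<open>The bound is attained within the family being maximised, namely at
      \<open>?w\<close>.\<close>
    have "?w \<in> A \<rightarrow>\<^sub>E (UNIV :: bool set)"
      by simp
    then show "upper_bound A f \<in> (\<lambda>a. model_count A a f) ` (A \<rightarrow>\<^sub>E (UNIV :: bool set))"
      using w by (metis imageI)
  qed
  then show ?thesis
    using w assms(10) by (simp add: lower_bound_def)
qed

end
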